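(* Fix a real $\gamma\in(0,1)$ and suppose $\tau\le\sqrt{\frac{1}{2-\gamma}}$. Set $$\lambda:=\frac{\gamma\mu^2}{\rho L}\qquad\text{and}\qquad q:=\sqrt{1-(1-\gamma)\tau^2}.$$ Let $x_0\in\mathcal{T}_\gamma$ and let $\{x_k\}$ be any sequence of iterates generated by the subgradient method with geometrically decreasing stepsize initialized at $x_0$: at step $k\ge0$, choose any $\zeta_k\in\partial g(x_k)$; if $\zeta_k=0$, the algorithm stops; otherwise set $\alpha_k=\lambda\cdot q^k$ and $x_{k+1}=\mathrm{proj}_{\mathcal{X}}\left(x_k-\alpha_k\frac{\zeta_k}{\|\zeta_k\|}\right)$. Then for every $k\ge 0$ for which $x_k$ is generated, $$\mathrm{dist}^2(x_k;\mathcal{X}^* )\le\frac{\gamma^2\mu^2}{\rho^2}\left(1-(1-\gamma)\tau^2\right)^k.$$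
   Context: $\mathbb{R}^d$ carries the Euclidean inner product and norm. For a set $\mathcal{Y}$, $\mathrm{dist}(y;\mathcal{Y})=\inf_{x\in\mathcal{Y}}\|y-x\|$, and $\mathrm{proj}_{\mathcal{Y}}(y)$ is the set of nearest points of $\mathcal{Y}$ to $y$ (a single point when $\mathcal{Y}$ is nonempty, closed and convex). Standing setting: consider $\min_{x\in\mathcal{X}}g(x)$, with fixed reals $\mu,\rho>0$, such that: (1) $g:\mathbb{R}^d\to\mathbb{R}$ is $\rho$-weakly convex, i.e. $x\mapsto g(x)+\frac{\rho}{2}\|x\|^2$ is convex; $\mathcal{X}\subset\mathbb{R}^d$ is closed and convex; and the set of minimizers $\mathcal{X}^*:=\mathrm{argmin}_{x\in\mathcal{X}}g(x)$ is nonempty. (2) (Sharpness) $g(x)-\min_{\mathcal{X}}g\ge\mu\cdot\mathrm{dist}(x;\mathcal{X}^* )$ for all $x\in\mathcal{X}$. The subdifferential $\partial g(x)$ is the set of all $v\in\mathbb{R}^d$ with $g(y)\ge g(x)+\langle v,y-x\rangle+o(\|y-x\|)$ as $y\to x$; for $\rho$-weakly convex $g$ this is equivalent to $g(y)\ge g(x)+\langle v,y-x\rangle-\frac{\rho}{2}\|y-x\|^2$ for all $y\in\mathbb{R}^d$. For $\gamma>0$, $\mathcal{T}_\gamma:=\{x\in\mathcal{X}:\mathrm{dist}(x;\mathcal{X}^* )<\gamma\mu/\rho\}$. Set $L:=\sup\{\|\zeta\|:\zeta\in\partial g(x),\ x\in\mathcal{T}_1\}$ and $\tau:=\mu/L$,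 where $\tau\in[0,1]$. The algorithm takes as data reals $\lambda>0$ and $q\in(0,1)$, so here $L<\infty$. *)

theory Defs
  imports "HOL-Analysis.Analysis" "HOL-Library.Landau_Symbols" "HOL-Library.Extended_Nat"
begin

definition weakly_convex :: "real \<Rightarrow> ('a::euclidean_space \<Rightarrow> real) \<Rightarrow> bool" where
  "weakly_convex \<rho> g \<longleftrightarrow> convex_on UNIV (\<lambda>x. g x + \<rho> / 2 * (norm x)\<^sup>2)"

definition argmin_set :: "('a \<Rightarrow> real) \<Rightarrow> 'a set \<Rightarrow> 'a set" where
  "argmin_set g X = {x. is_arg_min g (\<lambda>y. y \<in> X) x}"

(* The infimum over X is a minimum as soon as argmin_set g X is nonempty, which is assumed
   wherever this definition is used. *)
definition sharp_on :: "real \<Rightarrow> ('a::euclidean_space \<Rightarrow> real) \<Rightarrow> 'a set \<Rightarrow> bool" where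
  "sharp_on \<mu> g X \<longleftrightarrow>
     (\<forall>x\<in>X. g x - (INF y\<in>X. g y) \<ge> \<mu> * infdist x (argmin_set g X))"

(* Frechet subdifferential; the function r is the remainder o(norm (y - x)) as y tends to x. *)
definition subdifferential :: "('a::euclidean_space \<Rightarrow> real) \<Rightarrow> 'a \<Rightarrow> 'a set" where
  "subdifferential g x =
     {v. \<exists>r. r \<in> o[at x](\<lambda>y. norm (y - x)) \<and>
             (\<forall>\<^sub>F y in at x. g y \<ge> g x + v \<bullet> (y - x) + r y)}"

definition tube :: "real \<Rightarrow> real \<Rightarrow> ('a::euclidean_space \<Rightarrow> real) \<Rightarrow> 'a set \<Rightarrow> real \<Rightarrow> 'a set" where
  "tube \<mu> \<rho> g X \<gamma> = {x \<in> X. infdist x (argmin_set g X) < \<gamma> * \<mu> / \<rho>}"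

definition tube_subgradient_norms ::
  "real \<Rightarrow> real \<Rightarrow> ('a::euclidean_space \<Rightarrow> real) \<Rightarrow> 'a set \<Rightarrow> real set" where
  "tube_subgradient_norms \<mu> \<rho> g X =
     {norm \<zeta> | \<zeta> x. x \<in> tube \<mu> \<rho> g X 1 \<and> \<zeta> \<in> subdifferential g x}"

(* A complete run of the method. N is the index of the last generated iterate, infinite if the
   method never stops; the values x k and z k for k > N carry no meaning. *)
definition geometric_subgradient_run ::
  "('a::euclidean_space \<Rightarrow> real) \<Rightarrow> 'a set \<Rightarrow> real \<Rightarrow> real \<Rightarrow>
   (nat \<Rightarrow> 'a) \<Rightarrow> (nat \<Rightarrow> 'a) \<Rightarrow> enat \<Rightarrow> bool" where
  "geometric_subgradient_run g X lam q x z N \<longleftrightarrow>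
     (\<forall>k. enat k \<le> N \<longrightarrow>
        z k \<in> subdifferential g (x k) \<and>
        (if z k = 0 then N = enat k
         else enat (Suc k) \<le> N \<and>
              x (Suc k) = closest_point X (x k - (lam * q ^ k) *\<^sub>R (z k /\<^sub>R norm (z k)))))"

end

theory Submission imports Defs begin

text \<open>
  Write \<open>E\<close> for the distance of the current iterate to the solution set, \<open>p\<close> for a nearest
  solution, and \<open>M = (\<gamma> \<mu> / \<rho>) q ^ k\<close> for the bound to be propagated.  The projection is
  nonexpansive and fixes \<open>p\<close>, so expanding the square of the projected step gives
  \<open>E'\<^sup>2 \<le> E\<^sup>2 - 2 \<alpha> (\<zeta> \<bullet> (x - p)) / norm \<zeta> + \<alpha>\<^sup>2\<close>.
  Weak convexity makes the subgradient inequality global up to the error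
  \<open>\<rho> / 2 * E\<^sup>2\<close> (\<open>weakly_convex_subgradient_inequality\<close>), while sharpness forces a function
  gap of at least \<open>\<mu> E\<close>; together \<open>\<zeta> \<bullet> (x - p) \<ge> \<mu> E - \<rho> / 2 * E\<^sup>2\<close>.  Inside the tube of
  radius \<open>\<gamma> \<mu> / \<rho>\<close> this is at least \<open>(1 - \<gamma> / 2) \<mu> E\<close>, and \<open>norm \<zeta> \<le> L\<close>.

  The stepsize is exactly \<open>\<alpha> = \<tau> M\<close>, so the recursion becomes
  \<open>E'\<^sup>2 \<le> E\<^sup>2 - (2 - \<gamma>) \<tau>\<^sup>2 M E + \<tau>\<^sup>2 M\<^sup>2\<close>.  The right-hand side differs from the target
  \<open>q\<^sup>2 M\<^sup>2\<close> by the product of \<open>M - E\<close> and \<open>M + E - (2 - \<gamma>) \<tau>\<^sup>2 M\<close>, and the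
  assumption on \<open>\<tau>\<close> says precisely that \<open>(2 - \<gamma>) \<tau>\<^sup>2 \<le> 1\<close>.  Hence the bound shrinks by
  the factor \<open>q\<close> at each step, which also keeps the iterates in the tube.
\<close>

text \<open>
  The local inequality is compared, at a point of the segment from \<open>x\<close> to \<open>y\<close> close to \<open>x\<close>,
  with the upper bound that convexity of \<open>g + \<rho> / 2 * norm\<^sup>2\<close> gives there; dividing by the
  segment parameter leaves an error \<open>c * norm (y - x)\<close> with arbitrarily small \<open>c\<close>.
\<close>
lemma weakly_convex_subgradient_inequality:
  fixes g :: "'a::euclidean_space \<Rightarrow> real"
  assumes wc: "weakly_convex \<rho> g" and rho: "\<rho> \<ge> 0" and v: "v \<in> subdifferential g x"
  shows "g y \<ge> g x + v \<bullet> (y - x) - \<rho> / 2 * (norm (y - x))\<^sup>2"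
proof (cases "y = x")
  case True
  then show ?thesis by simp
next
  case False
  define n where "n = norm (y - x)"
  have n: "n > 0" using False by (simp add: n_def)
  from v obtain r where r: "r \<in> o[at x](\<lambda>y. norm (y - x))"
    and loc: "\<forall>\<^sub>F y in at x. g y \<ge> g x + v \<bullet> (y - x) + r y"
    unfolding subdifferential_def by blast
  have "g x + v \<bullet> (y - x) - \<rho> / 2 * n\<^sup>2 \<le> g y + e" if e: "e > 0" for e
  proof -
    define c where "c = e / n"
    have c: "c > 0" using e n by (simp add: c_def)
    have "\<forall>\<^sub>F w in at x. norm (r w) \<le> c * norm (norm (w - x))"
      using landau_o.smallD[OF r c] .
    then have "\<forall>\<^sub>F w in at x. g w \<ge> g x + v \<bullet> (w - x) - c * norm (w - x)"
      using loc by eventually_elim auto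
    then obtain d where d: "d > 0"
      and dd: "\<And>w. w \<noteq> x \<Longrightarrow> dist w x < d \<Longrightarrow> g w \<ge> g x + v \<bullet> (w - x) - c * norm (w - x)"
      unfolding eventually_at by blast
    define t where "t = min 1 (d / (2 * n))"
    have t: "t > 0" "t \<le> 1" using d n by (auto simp: t_def)
    have "t * n \<le> d / (2 * n) * n" using n by (intro mult_right_mono) (auto simp: t_def)
    also have "\<dots> < d" using d n by simp
    finally have tn: "t * n < d" .
    define w where "w = (1 - t) *\<^sub>R x + t *\<^sub>R y"
    have wx: "w - x = t *\<^sub>R (y - x)" by (simp add: w_def algebra_simps)
    have nw: "norm (w - x) = t * n" using t by (simp add: wx n_def)
    have "w \<noteq> x" using nw t n by auto
    then have low: "g w \<ge> g x + t * (v \<bullet> (y - x)) - c * (t * n)"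
      using dd[of w] nw tn by (simp add: dist_norm wx)
    have conv: "g w + \<rho> / 2 * (norm w)\<^sup>2
        \<le> (1 - t) * (g x + \<rho> / 2 * (norm x)\<^sup>2) + t * (g y + \<rho> / 2 * (norm y)\<^sup>2)"
      using wc t unfolding weakly_convex_def w_def by (intro convex_onD) auto
    have sq: "(norm w)\<^sup>2 = (1 - t) * (norm x)\<^sup>2 + t * (norm y)\<^sup>2 - t * (1 - t) * n\<^sup>2"
      unfolding w_def n_def power2_norm_eq_inner
      by (simp add: inner_simps inner_commute algebra_simps)
    have up: "g w \<le> (1 - t) * g x + t * g y + \<rho> / 2 * (t * (1 - t) * n\<^sup>2)"
      using conv unfolding sq by (simp add: field_simps)
    have "\<rho> / 2 * (t * (1 - t) * n\<^sup>2) \<le> \<rho> / 2 * (t * n\<^sup>2)"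
      using t rho by (intro mult_left_mono mult_right_mono) auto
    with up low have "t * (g x + v \<bullet> (y - x) - \<rho> / 2 * n\<^sup>2) \<le> t * (g y + c * n)"
      by (simp add: algebra_simps)
    then show ?thesis using t n by (simp add: c_def)
  qed
  then show ?thesis unfolding n_def by (rule field_le_epsilon)
qed

lemma argmin_set_iff:
  fixes g :: "'a \<Rightarrow> real"
  shows "x \<in> argmin_set g X \<longleftrightarrow> x \<in> X \<and> (\<forall>y\<in>X. g x \<le> g y)"
  unfolding argmin_set_def is_arg_min_def by (auto simp: not_less)

text \<open>
  Closedness is needed for the distance to the solution set to be attained.  Continuity of \<open>g\<close>
  is automatic, because a finite convex function on the whole space is continuous.
\<close>
lemma closed_argmin_set_weakly_convex:
  fixes g :: "'a::euclidean_space \<Rightarrow> real"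
  assumes "weakly_convex \<rho> g" and "closed X"
  shows "closed (argmin_set g X)"
proof -
  have "continuous_on UNIV (\<lambda>x. g x + \<rho> / 2 * (norm x)\<^sup>2)"
    using assms(1) unfolding weakly_convex_def by (intro convex_on_continuous) auto
  then have "continuous_on UNIV (\<lambda>x. (g x + \<rho> / 2 * (norm x)\<^sup>2) - \<rho> / 2 * (norm x)\<^sup>2)"
    by (rule continuous_on_diff) (auto intro!: continuous_intros)
  then have cont: "continuous_on UNIV g" by simp
  have "closed {x. g x \<le> g y}" for y
    using cont by (intro closed_Collect_le continuous_intros) auto
  then have "closed (X \<inter> (\<Inter>y\<in>X. {x. g x \<le> g y}))"
    using assms(2) by (intro closed_Int closed_INT) auto
  moreover have "argmin_set g X = X \<inter> (\<Inter>y\<in>X. {x. g x \<le> g y})"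
    by (auto simp: argmin_set_iff)
  ultimately show ?thesis by simp
qed

lemma sharp_on_gap:
  assumes "sharp_on \<mu> g X" and "p \<in> argmin_set g X" and "x \<in> X"
  shows "\<mu> * infdist x (argmin_set g X) \<le> g x - g p"
proof -
  have "(INF y\<in>X. g y) = g p"
    using assms(2) by (intro cInf_eq_minimum) (auto simp: argmin_set_iff)
  then show ?thesis using assms(1,3) unfolding sharp_on_def by force
qed

lemma projected_normalized_step:
  fixes p :: "'a::euclidean_space"
  assumes "convex X" "closed X" "p \<in> X" "z \<noteq> 0"
  shows "(dist (closest_point X (x - a *\<^sub>R (z /\<^sub>R norm z))) p)\<^sup>2
           \<le> (norm (x - p))\<^sup>2 - 2 * a / norm z * (z \<bullet> (x - p)) + a\<^sup>2"
proof -
  define u where "u = z /\<^sub>R norm z"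
  have "norm u = 1" using assms(4) by (simp add: u_def)
  have "dist (closest_point X (x - a *\<^sub>R u)) (closest_point X p) \<le> dist (x - a *\<^sub>R u) p"
    using assms by (intro closest_point_lipschitz) auto
  then have "dist (closest_point X (x - a *\<^sub>R u)) p \<le> norm ((x - p) - a *\<^sub>R u)"
    using assms(3) by (simp add: closest_point_self dist_norm algebra_simps)
  then have "(dist (closest_point X (x - a *\<^sub>R u)) p)\<^sup>2 \<le> (norm ((x - p) - a *\<^sub>R u))\<^sup>2"
    by (intro power_mono) auto
  also have "\<dots> = (norm (x - p))\<^sup>2 - 2 * a * (u \<bullet> (x - p)) + a\<^sup>2 * (norm u)\<^sup>2"
    unfolding power2_norm_eq_inner
    by (simp add: inner_simps inner_commute algebra_simps power2_eq_square)
  finally show ?thesis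
    using \<open>norm u = 1\<close> by (simp add: u_def divide_simps)
qed

text \<open>
  Weak convexity bounds the loss in the subgradient inequality at a nearest minimizer, and
  sharpness beats it as long as the iterate is within \<open>2 \<mu> / \<rho>\<close> of the minimizers.  In that range the
  decrease term is nonnegative, so the norm of the subgradient may be replaced by any upper bound.
\<close>
lemma subgradient_step_infdist:
  fixes g :: "'a::euclidean_space \<Rightarrow> real" and X :: "'a set" and x z :: 'a
  defines "S \<equiv> argmin_set g X"
  defines "E \<equiv> infdist x S"
  assumes wc: "weakly_convex \<rho> g" and rho: "\<rho> \<ge> 0"
    and X: "closed X" "convex X" and ne: "S \<noteq> {}" and sharp: "sharp_on \<mu> g X"
    and x: "x \<in> X" and z: "z \<in> subdifferential g x" "z \<noteq> 0" "norm z \<le> L"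
    and a: "a \<ge> 0" and near: "\<rho> * E \<le> 2 * \<mu>"
  shows "(infdist (closest_point X (x - a *\<^sub>R (z /\<^sub>R norm z))) S)\<^sup>2
           \<le> E\<^sup>2 - a / L * (E * (2 * \<mu> - \<rho> * E)) + a\<^sup>2" (is "(infdist ?x' S)\<^sup>2 \<le> _")
proof -
  have "closed S" unfolding S_def using wc X(1) by (rule closed_argmin_set_weakly_convex)
  then obtain p where p: "p \<in> S" and Ep: "E = dist x p"
    unfolding E_def using ne by (rule infdist_attains_inf)
  have pX: "p \<in> X" using p unfolding S_def by (simp add: argmin_set_iff)
  have nE: "norm (x - p) = E" and nE': "norm (p - x) = E"
    by (simp_all add: Ep dist_norm norm_minus_commute)
  have "g p \<ge> g x + z \<bullet> (p - x) - \<rho> / 2 * E\<^sup>2"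
    using weakly_convex_subgradient_inequality[OF wc rho z(1), of p] by (simp add: nE')
  moreover have "\<mu> * E \<le> g x - g p"
    using sharp_on_gap[OF sharp, of p x] p x unfolding S_def E_def by simp
  ultimately have ang: "E * (2 * \<mu> - \<rho> * E) \<le> 2 * (z \<bullet> (x - p))"
    by (simp add: inner_diff_right power2_eq_square algebra_simps)
  have zp: "norm z > 0" using z(2) by simp
  have "0 \<le> E" by (simp add: Ep)
  have "a / L * (E * (2 * \<mu> - \<rho> * E)) \<le> a / norm z * (E * (2 * \<mu> - \<rho> * E))"
    using a zp z(3) near \<open>0 \<le> E\<close> order.strict_trans2[OF zp z(3)]
    by (intro mult_right_mono divide_left_mono mult_pos_pos mult_nonneg_nonneg) auto
  also have "\<dots> \<le> a / norm z * (2 * (z \<bullet> (x - p)))"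
    using a zp ang by (intro mult_left_mono) auto
  finally have dec: "a / L * (E * (2 * \<mu> - \<rho> * E)) \<le> 2 * a / norm z * (z \<bullet> (x - p))"
    by (simp add: mult.left_commute mult.assoc)
  have "(infdist ?x' S)\<^sup>2 \<le> (dist ?x' p)\<^sup>2"
    using p by (intro power_mono infdist_le infdist_nonneg)
  also have "\<dots> \<le> E\<^sup>2 - 2 * a / norm z * (z \<bullet> (x - p)) + a\<^sup>2"
    using projected_normalized_step[OF X(2,1) pX z(2), of x a] by (simp add: nE)
  finally show ?thesis using dec by linarith
qed

text \<open>
  Replacing \<open>\<rho> E\<close> by its upper bound \<open>\<gamma> \<mu>\<close> only increases the left-hand side; after that the
  right-hand side minus the left-hand side factors as \<open>M - E\<close> times
  \<open>M + E - (2 - \<gamma>) \<tau>\<^sup>2 M\<close>, and both factors are nonnegative.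
\<close>
lemma geometric_contraction:
  fixes E M \<gamma> \<mu> \<rho> \<tau> L :: real
  assumes "0 \<le> E" "E \<le> M" "0 \<le> \<rho>" "\<rho> * M \<le> \<gamma> * \<mu>" "L > 0" "0 \<le> \<tau>" "\<tau> = \<mu> / L"
    and tau: "(2 - \<gamma>) * \<tau>\<^sup>2 \<le> 1"
  shows "E\<^sup>2 - (\<tau> * M) / L * (E * (2 * \<mu> - \<rho> * E)) + (\<tau> * M)\<^sup>2 \<le> (1 - (1 - \<gamma>) * \<tau>\<^sup>2) * M\<^sup>2"
proof -
  have mu: "\<mu> = \<tau> * L" using assms(5,7) by simp
  have "\<rho> * E \<le> \<rho> * M" using assms(2,3) by (intro mult_left_mono) auto
  then have "(2 - \<gamma>) * \<mu> \<le> 2 * \<mu> - \<rho> * E" using assms(4) by (simp add: algebra_simps)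
  then have "(\<tau> * M) / L * (E * ((2 - \<gamma>) * \<mu>)) \<le> (\<tau> * M) / L * (E * (2 * \<mu> - \<rho> * E))"
    using assms(1,2,5,6) by (intro mult_left_mono divide_nonneg_pos mult_nonneg_nonneg) auto
  moreover have "(\<tau> * M) / L * (E * ((2 - \<gamma>) * \<mu>)) = (2 - \<gamma>) * \<tau>\<^sup>2 * M * E"
    using assms(5) unfolding mu by (simp add: power2_eq_square)
  moreover have "0 \<le> (M - E) * (M + E - (2 - \<gamma>) * \<tau>\<^sup>2 * M)"
  proof -
    have "(2 - \<gamma>) * \<tau>\<^sup>2 * M \<le> 1 * M" using assms(1,2) tau by (intro mult_right_mono) auto
    then show ?thesis using assms(1,2) by (intro mult_nonneg_nonneg) auto
  qed
  ultimately show ?thesis by (simp add: algebra_simps power2_eq_square)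
qed

lemma subgradient_norm_le_Sup:
  assumes "bdd_above (tube_subgradient_norms \<mu> \<rho> g X)"
    and "x \<in> tube \<mu> \<rho> g X 1" and "z \<in> subdifferential g x"
  shows "norm z \<le> Sup (tube_subgradient_norms \<mu> \<rho> g X)"
  using assms by (intro cSup_upper) (auto simp: tube_subgradient_norms_def)

theorem theorem5p1:
  fixes g :: "'a::euclidean_space \<Rightarrow> real" and X :: "'a set"
    and \<mu> \<rho> \<gamma> L \<tau> lam q :: real
    and x \<zeta> :: "nat \<Rightarrow> 'a" and N :: enat
  assumes "\<mu> > 0" and "\<rho> > 0"
    and "weakly_convex \<rho> g"
    and "closed X" and "convex X"
    and "argmin_set g X \<noteq> {}"
    and "sharp_on \<mu> g X"
    and "bdd_above (tube_subgradient_norms \<mu> \<rho> g X)"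
    and "L = Sup (tube_subgradient_norms \<mu> \<rho> g X)"
    and "L > 0"
    and "\<tau> = \<mu> / L"
    and "0 < \<gamma>" and "\<gamma> < 1"
    and "\<tau> \<le> sqrt (1 / (2 - \<gamma>))"
    and "lam = \<gamma> * \<mu>\<^sup>2 / (\<rho> * L)"
    and "q = sqrt (1 - (1 - \<gamma>) * \<tau>\<^sup>2)"
    and "x 0 \<in> tube \<mu> \<rho> g X \<gamma>"
    and "geometric_subgradient_run g X lam q x \<zeta> N"
  shows "\<forall>k. enat k \<le> N \<longrightarrow>
    (infdist (x k) (argmin_set g X))\<^sup>2
      \<le> \<gamma>\<^sup>2 * \<mu>\<^sup>2 / \<rho>\<^sup>2 * (1 - (1 - \<gamma>) * \<tau>\<^sup>2) ^ k"
proof -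
  let ?S = "argmin_set g X"
  define D where "D = \<gamma> * \<mu> / \<rho>"
  have D: "D > 0" "\<rho> * D = \<gamma> * \<mu>" using assms(1,2,12) by (auto simp: D_def)
  have tau0: "\<tau> \<ge> 0" using assms(1,10,11) by simp
  have "\<tau>\<^sup>2 \<le> (sqrt (1 / (2 - \<gamma>)))\<^sup>2"
    using assms(14) tau0 by (rule power_mono)
  then have tau: "(2 - \<gamma>) * \<tau>\<^sup>2 \<le> 1" using assms(13) by (simp add: field_simps)
  have rad: "0 \<le> 1 - (1 - \<gamma>) * \<tau>\<^sup>2"
  proof -
    have "(1 - \<gamma>) * \<tau>\<^sup>2 \<le> (2 - \<gamma>) * \<tau>\<^sup>2" by (intro mult_right_mono) auto
    then show ?thesis using tau by linarith
  qed
  have q2: "q\<^sup>2 = 1 - (1 - \<gamma>) * \<tau>\<^sup>2"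
    using rad unfolding assms(16) by (rule real_sqrt_pow2)
  have q: "0 \<le> q" "q \<le> 1"
    using rad assms(13) unfolding assms(16) by auto
  have lam: "lam = \<tau> * D"
    unfolding assms(11,15) D_def by (simp add: power2_eq_square mult_ac)
  have inv: "x k \<in> X \<and> infdist (x k) ?S \<le> D * q ^ k" if "enat k \<le> N" for k
    using that
  proof (induction k)
    case 0
    then show ?case using assms(17) by (auto simp: tube_def D_def)
  next
    case (Suc k)
    define E where "E = infdist (x k) ?S"
    define M where "M = D * q ^ k"
    have kN: "enat k \<le> N" using Suc.prems by (meson Suc_ile_eq order_less_imp_le)
    have IH: "x k \<in> X" "E \<le> M" using Suc.IH[OF kN] by (auto simp: E_def M_def)
    have E: "0 \<le> E" by (simp add: E_def infdist_nonneg)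
    have z: "\<zeta> k \<in> subdifferential g (x k)" and
      step: "if \<zeta> k = 0 then N = enat k else enat (Suc k) \<le> N \<and>
        x (Suc k) = closest_point X (x k - (lam * q ^ k) *\<^sub>R (\<zeta> k /\<^sub>R norm (\<zeta> k)))"
      using assms(18) kN unfolding geometric_subgradient_run_def by blast+
    have z0: "\<zeta> k \<noteq> 0" using step Suc.prems by auto
    have "lam * q ^ k = \<tau> * M" by (simp add: lam M_def)
    then have xS: "x (Suc k) = closest_point X (x k - (\<tau> * M) *\<^sub>R (\<zeta> k /\<^sub>R norm (\<zeta> k)))"
      using step z0 by simp
    have "M \<le> D" using D(1) q by (simp add: M_def power_le_one mult_left_le)
    then have rM: "\<rho> * M \<le> \<gamma> * \<mu>"
      using assms(2) D(2) by (metis mult_left_mono order_less_imp_le)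
    have rE: "\<rho> * E \<le> \<rho> * M" using IH(2) assms(2) by simp
    have gm: "\<gamma> * \<mu> < \<mu>" using assms(1,13) by simp
    have "\<rho> * E < \<mu>" using rE rM gm by linarith
    then have "E < \<mu> / \<rho>" using assms(2) by (simp add: field_simps)
    then have "x k \<in> tube \<mu> \<rho> g X 1" using IH(1) by (simp add: tube_def E_def)
    then have zL: "norm (\<zeta> k) \<le> L"
      using subgradient_norm_le_Sup[OF assms(8) _ z] assms(9) by simp
    have M0: "0 \<le> M" using E IH(2) by simp
    have "(infdist (x (Suc k)) ?S)\<^sup>2
        \<le> E\<^sup>2 - (\<tau> * M) / L * (E * (2 * \<mu> - \<rho> * E)) + (\<tau> * M)\<^sup>2"
      unfolding xS E_def
    proof (rule subgradient_step_infdist[OF assms(3) _ assms(4-7) IH(1) z z0 zL])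
      show "0 \<le> \<rho>" using assms(2) by simp
      show "0 \<le> \<tau> * M" using tau0 M0 by simp
      show "\<rho> * infdist (x k) ?S \<le> 2 * \<mu>"
        using rE rM gm assms(1) unfolding E_def[symmetric] by linarith
    qed
    also have "\<dots> \<le> (1 - (1 - \<gamma>) * \<tau>\<^sup>2) * M\<^sup>2"
      by (rule geometric_contraction[OF E IH(2) _ rM assms(10) tau0 assms(11) tau])
        (use assms(2) in simp)
    also have "\<dots> = (D * q ^ Suc k)\<^sup>2"
      by (simp add: q2[symmetric] M_def power_mult_distrib)
    finally have "infdist (x (Suc k)) ?S \<le> D * q ^ Suc k"
      by (rule power2_le_imp_le) (use D(1) q(1) in simp)
    moreover have "x (Suc k) \<in> X"
      unfolding xS using assms(4) IH(1) by (intro closest_point_in_set) auto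
    ultimately show ?case by blast
  qed
  show ?thesis
  proof (intro allI impI)
    fix k assume "enat k \<le> N"
    then have "(infdist (x k) ?S)\<^sup>2 \<le> (D * q ^ k)\<^sup>2"
      using inv by (intro power_mono infdist_nonneg) auto
    also have "\<dots> = D\<^sup>2 * (q\<^sup>2) ^ k"
      by (metis power_mult power_mult_distrib mult.commute)
    also have "\<dots> = \<gamma>\<^sup>2 * \<mu>\<^sup>2 / \<rho>\<^sup>2 * (1 - (1 - \<gamma>) * \<tau>\<^sup>2) ^ k"
      by (simp add: q2 D_def power_mult_distrib power_divide)
    finally show "(infdist (x k) ?S)\<^sup>2
      \<le> \<gamma>\<^sup>2 * \<mu>\<^sup>2 / \<rho>\<^sup>2 * (1 - (1 - \<gamma>) * \<tau>\<^sup>2) ^ k" .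
  qed
qed

end
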